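(* Let $(X,d)$ be a complete metric space and $(Y,\varrho)$ be a metric space. Consider a point $\bar x\in X$, a continuous mapping $g:X\to Y$, whose domain is all of $X$, and positive constants $c$ and $r$. (i) Assume that for every $x\in\mathbb{B}(\bar x,r)$ and every $y\in\mathbb{B}(g(\bar x),cr)$ satisfying $$0<\varrho(g(x),y)\le\varrho(g(\bar x),y)-c\,d(x,\bar x)$$ there is a point $x'\in X$ such that $$\varrho(g(x'),y)<\varrho(g(x),y)-c\,d(x,x').$$ Then $g\big(\mathbb{B}(\bar x,t)\big)\supset\mathbb{B}(g(\bar x),ct)$ for every $t\in(0,r)$. (ii) Assume that $g\big(\mathbb{B}(\bar x,t)\big)\supset\mathbb{B}(g(\bar x),ct)$ for every $t\in(0,r)$. Then for every $c'\in(0,c)$, every $x\in\mathbb{B}(\bar x,r)$, and every $y\in\mathbb{B}(g(\bar x),c'r)$ satisfying $$0<\varrho(g(\bar x),y)\le\varrho(g(x),y)-c'\,d(x,\bar x)$$ there is a point $x'\in X$ such that $$\varrho(g(x'),y)<\varrho(g(x),y)-c'\,d(x,x').$$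
   Context: $\mathbb{B}(u,r)$ denotes the open ball with centre $u$ and radius $r>0$. *)

theory Defs
  imports "HOL-Analysis.Analysis"
begin

end

theory Submission
  imports Defs
begin

text \<open>
  The first part is Ekeland's variational principle applied to the distance to the target \<open>y\<close>,
  that is, to \<open>f x = dist (g x) y\<close>. The principle produces a point \<open>x\<close> from which no
  move lowers \<open>f\<close> at a rate above \<open>c\<close>, and which itself is reached from \<open>xbar\<close> with a descent
  rate of at least \<open>c\<close>. Since \<open>f\<close> is nonnegative, the descent rate bounds the distance travelled by
  \<open>f xbar / c < t\<close>. If \<open>f x\<close> were positive, the hypothesis would provide exactly the move that is
  excluded at \<open>x\<close>; so \<open>f x = 0\<close>, which means that \<open>g x = y\<close>.

  The second part needs no limit process: choose \<open>x'\<close> with \<open>g x' = y\<close>. Because \<open>c' < c\<close>, openness at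
  rate \<open>c\<close> allows \<open>c' * dist xbar x' < dist (g xbar) y\<close>, and the triangle inequality through
  \<open>xbar\<close> does the rest.
\<close>

text \<open>
  Ekeland's principle follows from a greedy descent. Write \<open>S x\<close> for the points that can be reached
  from \<open>x\<close> with descent rate at least \<open>c\<close>; this relation is transitive. Choose each new iterate
  in \<open>S\<close> of the current one with nearly minimal value there. The values decrease and are
  bounded below, so the steps, which the values control, form a Cauchy sequence. A point
  reachable from the limit at rate \<open>c\<close> is reachable from every iterate; by near minimality its
  value is therefore at least that of the limit.
\<close>
lemma Ekeland_variational_principle:
  fixes f :: "'a::complete_space \<Rightarrow> real"
  assumes cont: "continuous_on UNIV f" and bound: "\<And>x. B \<le> f x" and c: "c > 0"
  obtains x where "f x + c * dist x0 x \<le> f x0" "\<And>x'. f x \<le> f x' + c * dist x x'"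
proof -
  define S where "S x = {z. f z + c * dist x z \<le> f x}" for x
  have S_refl: "x \<in> S x" for x
    by (simp add: S_def)
  have S_trans: "z \<in> S x" if "y \<in> S x" "z \<in> S y" for x y z
  proof -
    have "c * dist x z \<le> c * dist x y + c * dist y z"
      using c dist_triangle[of x z y] by (simp flip: distrib_left)
    then show ?thesis using that by (simp add: S_def)
  qed
  have bdd: "bdd_below (f ` S x)" for x
    using bound by (auto intro!: bdd_belowI)
  have step: "\<exists>y. y \<in> S x \<and> (\<forall>z\<in>S x. f y \<le> f z + inverse (real (Suc n)))" for x n
  proof -
    have "Inf (f ` S x) < Inf (f ` S x) + inverse (real (Suc n))"
      by simp
    moreover have "f ` S x \<noteq> {}"
      using S_refl by blast
    ultimately obtain y where y: "y \<in> S x" "f y < Inf (f ` S x) + inverse (real (Suc n))"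
      using cInf_lessD[of "f ` S x"] by blast
    have "f y \<le> f z + inverse (real (Suc n))" if "z \<in> S x" for z
      using y(2) cInf_lower[OF imageI[OF that] bdd] by linarith
    with y(1) show ?thesis by blast
  qed
  have "\<exists>u. u 0 = x0 \<and>
      (\<forall>n. u (Suc n) \<in> S (u n) \<and> (\<forall>z\<in>S (u n). f (u (Suc n)) \<le> f z + inverse (real (Suc n))))"
    using dependent_nat_choice[of "\<lambda>n x. n = 0 \<longrightarrow> x = x0"
        "\<lambda>n x y. y \<in> S x \<and> (\<forall>z\<in>S x. f y \<le> f z + inverse (real (Suc n)))"] step by auto
  then obtain u where u0: "u 0 = x0" and u_S: "\<And>n. u (Suc n) \<in> S (u n)"
    and u_min: "\<And>n z. z \<in> S (u n) \<Longrightarrow> f (u (Suc n)) \<le> f z + inverse (real (Suc n))"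
    by blast
  have reach: "u m \<in> S (u n)" if "n \<le> m" for n m
    using that by (induction rule: dec_induct) (auto intro: S_refl S_trans u_S)
  have decr: "f (u m) + c * dist (u n) (u m) \<le> f (u n)" if "n \<le> m" for n m
    using reach[OF that] by (simp add: S_def)
  have "decseq (\<lambda>n. f (u n))"
    using u_S c by (fastforce simp: S_def decseq_Suc_iff intro: order_trans[rotated])
  then have "convergent (\<lambda>n. f (u n))"
    using bound decseq_convergent[of "\<lambda>n. f (u n)" B] by (metis convergentI)
  then have val_Cauchy: "Cauchy (\<lambda>n. f (u n))"
    by (rule convergent_Cauchy)
  have "Cauchy u"
    unfolding Cauchy_altdef
  proof (intro allI impI)
    fix e :: real assume "e > 0"
    then have "c * e > 0" using c by simp
    then obtain M where M: "\<And>m n. m \<ge> M \<Longrightarrow> n > m \<Longrightarrow> dist (f (u m)) (f (u n)) < c * e"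
      using val_Cauchy unfolding Cauchy_altdef by blast
    have "dist (u m) (u n) < e" if "m \<ge> M" "n > m" for m n
    proof -
      have "c * dist (u m) (u n) < c * e"
        using decr[of m n] M[OF that] that by (simp add: dist_real_def)
      then show ?thesis using c by simp
    qed
    then show "\<exists>M. \<forall>m\<ge>M. \<forall>n>m. dist (u m) (u n) < e" by blast
  qed
  then obtain x where lim: "u \<longlonglongrightarrow> x"
    using Cauchy_convergent convergent_def by blast
  then have f_lim: "(\<lambda>n. f (u n)) \<longlonglongrightarrow> f x"
    using cont continuous_on_tendsto_compose[OF cont lim] by simp
  have x_reach: "x \<in> S (u n)" for n
  proof -
    have "(\<lambda>m. f (u m) + c * dist (u n) (u m)) \<longlonglongrightarrow> f x + c * dist (u n) x"
      by (intro tendsto_intros lim f_lim)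
    then have "f x + c * dist (u n) x \<le> f (u n)"
      by (rule LIMSEQ_le_const2) (use decr in blast)
    then show ?thesis by (simp add: S_def)
  qed
  have "f x \<le> f x' + c * dist x x'" for x'
  proof (rule ccontr)
    assume less: "\<not> ?thesis"
    then have "x' \<in> S x" by (simp add: S_def)
    then have "f (u (Suc n)) \<le> f x' + inverse (real (Suc n))" for n
      using S_trans x_reach u_min by blast
    moreover have "(\<lambda>n. f x' + inverse (real (Suc n))) \<longlonglongrightarrow> f x' + 0"
      by (intro tendsto_intros LIMSEQ_inverse_real_of_nat)
    ultimately have "f x \<le> f x'"
      using LIMSEQ_le[OF LIMSEQ_Suc[OF f_lim]] by fastforce
    moreover have "0 \<le> c * dist x x'" using c by simp
    ultimately show False using less by linarith
  qed
  moreover have "f x + c * dist x0 x \<le> f x0"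
    using x_reach[of 0] u0 by (simp add: S_def)
  ultimately show thesis using that by blast
qed

text \<open>
  The inequality \<open>dist (g x) y \<le> dist (g xbar) y - c * dist x xbar\<close> says that \<open>x\<close> is reached from
  \<open>xbar\<close> at descent rate \<open>c\<close>, which is why a descent move is demanded only at such points: the
  Ekeland point is one of them.
\<close>
lemma ball_subset_image_if_descent:
  fixes g :: "'a::complete_space \<Rightarrow> 'b::metric_space"
  assumes cont: "continuous_on UNIV g" and c: "c > 0" and t: "t < r"
    and descent: "\<And>x y. \<lbrakk>x \<in> ball xbar r; y \<in> ball (g xbar) (c * r); 0 < dist (g x) y;
         dist (g x) y \<le> dist (g xbar) y - c * dist x xbar\<rbrakk>
         \<Longrightarrow> \<exists>x'. dist (g x') y < dist (g x) y - c * dist x x'"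
  shows "ball (g xbar) (c * t) \<subseteq> g ` ball xbar t"
proof
  fix y assume "y \<in> ball (g xbar) (c * t)"
  then have y: "dist (g xbar) y < c * t" by simp
  have "continuous_on UNIV (\<lambda>x. dist (g x) y)"
    by (intro continuous_intros cont)
  then obtain x where x: "dist (g x) y + c * dist xbar x \<le> dist (g xbar) y"
    and min: "\<And>x'. dist (g x) y \<le> dist (g x') y + c * dist x x'"
    using Ekeland_variational_principle[of "\<lambda>x. dist (g x) y" 0 c xbar] c zero_le_dist by metis
  have "c * dist xbar x \<le> dist (g xbar) y"
    using x zero_le_dist[of "g x" y] by linarith
  then have "c * dist xbar x < c * t"
    using y by linarith
  then have x_t: "dist xbar x < t"
    using c by simp
  have "dist (g x) y = 0"
  proof (rule ccontr)
    assume "dist (g x) y \<noteq> 0"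
    then have "0 < dist (g x) y" by simp
    moreover have "x \<in> ball xbar r"
      using x_t t by simp
    moreover have "c * t < c * r"
      using c t by simp
    then have "y \<in> ball (g xbar) (c * r)"
      using y by simp
    ultimately obtain x' where "dist (g x') y < dist (g x) y - c * dist x x'"
      using descent[of x y] x by (auto simp: dist_commute)
    then show False using min[of x'] by linarith
  qed
  then show "y \<in> g ` ball xbar t"
    using x_t by auto
qed

lemma descent_if_ball_subset_image:
  fixes g :: "'a::metric_space \<Rightarrow> 'b::metric_space"
  assumes incl: "\<And>t. 0 < t \<Longrightarrow> t < r \<Longrightarrow> ball (g xbar) (c * t) \<subseteq> g ` ball xbar t"
    and c': "0 < c'" "c' < c"
    and y: "y \<in> ball (g xbar) (c' * r)" "0 < dist (g xbar) y"
    and le: "dist (g xbar) y \<le> dist (g x) y - c' * dist x xbar"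
  shows "\<exists>x'. dist (g x') y < dist (g x) y - c' * dist x x'"
proof -
  \<comment> \<open>This radius satisfies \<open>c' * t = dist (g xbar) y < c * t\<close>, so \<open>y\<close> is covered from within
    distance \<open>t\<close>, while \<open>t < r\<close> is what the choice of \<open>y\<close> gives.\<close>
  define t where "t = dist (g xbar) y / c'"
  have ct: "c' * t = dist (g xbar) y"
    using c' by (simp add: t_def)
  have t: "0 < t" "t < r"
    using y c' by (simp_all add: t_def field_simps)
  have "c' * t < c * t"
    using c' t by simp
  then have "y \<in> ball (g xbar) (c * t)"
    using ct by simp
  then obtain x' where x': "g x' = y" "dist xbar x' < t"
    using incl[OF t] by auto
  have "c' * dist xbar x' < c' * t"
    using x'(2) c' by simp
  moreover have "c' * dist x x' \<le> c' * dist x xbar + c' * dist xbar x'"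
    using c' dist_triangle[of x x' xbar] by (simp flip: distrib_left)
  ultimately have "dist (g x') y < dist (g x) y - c' * dist x x'"
    using le ct x'(1) by simp
  then show ?thesis by blast
qed

theorem proposition4p1:
  fixes g :: "'a::complete_space \<Rightarrow> 'b::metric_space"
    and xbar :: 'a
    and c r :: real
  assumes "continuous_on UNIV g"
    and "c > 0"
    and "r > 0"
  shows
    "((\<forall>x \<in> ball xbar r. \<forall>y \<in> ball (g xbar) (c * r).
         0 < dist (g x) y \<and> dist (g x) y \<le> dist (g xbar) y - c * dist x xbar \<longrightarrow>
         (\<exists>x'. dist (g x') y < dist (g x) y - c * dist x x'))
      \<longrightarrow> (\<forall>t \<in> {0<..<r}. ball (g xbar) (c * t) \<subseteq> g ` ball xbar t))
   \<and> ((\<forall>t \<in> {0<..<r}. ball (g xbar) (c * t) \<subseteq> g ` ball xbar t)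
      \<longrightarrow> (\<forall>c' \<in> {0<..<c}. \<forall>x \<in> ball xbar r. \<forall>y \<in> ball (g xbar) (c' * r).
         0 < dist (g xbar) y \<and> dist (g xbar) y \<le> dist (g x) y - c' * dist x xbar \<longrightarrow>
         (\<exists>x'. dist (g x') y < dist (g x) y - c' * dist x x')))"
proof (intro conjI impI ballI)
  fix t
  assume descent: "\<forall>x \<in> ball xbar r. \<forall>y \<in> ball (g xbar) (c * r).
         0 < dist (g x) y \<and> dist (g x) y \<le> dist (g xbar) y - c * dist x xbar \<longrightarrow>
         (\<exists>x'. dist (g x') y < dist (g x) y - c * dist x x')"
    and "t \<in> {0<..<r}"
  then show "ball (g xbar) (c * t) \<subseteq> g ` ball xbar t"
    using assms by (intro ball_subset_image_if_descent[of g c t r]) (simp_all only: greaterThanLessThan_iff)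
next
  fix c' x y
  assume "\<forall>t \<in> {0<..<r}. ball (g xbar) (c * t) \<subseteq> g ` ball xbar t"
    and "c' \<in> {0<..<c}" and "y \<in> ball (g xbar) (c' * r)"
    and "0 < dist (g xbar) y \<and> dist (g xbar) y \<le> dist (g x) y - c' * dist x xbar"
  then show "\<exists>x'. dist (g x') y < dist (g x) y - c' * dist x x'"
    by (intro descent_if_ball_subset_image[of r g xbar c c' y x]) (auto simp only: greaterThanLessThan_iff)
qed

end
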